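(* Let $T$ be the rooted binary tree with boundary $\partial T=\{0,1\}^{\mathbb N}$, let $\mu_1$ be the Bernoulli measure on $\partial T$, and let $\lambda$ be Lebesgue measure on $I=[0,1)$. Let $g\in Aut(T)$ be such that there exists $m\geq1$ such that for every $i>m$ and every sequence $w=w_1w_2\cdots\in\partial T$, the $i$-th entry of $g(w)$ equals $w_i$. Let $a\in Aut(T)$ be the adding machine. Then: (1) for some permutation $\pi$ of $2^m$ symbols, the rotated odometer $(I,F_\pi)$ (with $F_\pi$ built from the division of $I$ into $2^m$ intervals of length $2^{-m}$) admits an injective measure-preserving map $\phi:(I,\lambda)\to(\partial T,\mu_1)$ with $\phi\circ F_\pi=(a\circ g)\circ\phi$; (2) consequently, $a\circ g$ has infinite order, there is a clopen subset $U\subset\partial T$ such that the action of $\langle a\circ g\rangle$ restricted to $U$ is minimal, and there is $n_0\geq0$ such that every $x\in\partial T\setminus U$ is periodic of period $2^k$ for some $k\leq n_0$.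
   Context: The rooted binary tree $T$ has vertex levels $V_i$, $|V_i|=2^i$, vertices of $V_i$ labelled by words $w_1\cdots w_i\in\{0,1\}^i$, with $w_1\cdots w_i$ joined to $w_1\cdots w_i0$ and $w_1\cdots w_i1$. Its boundary $\partial T$ is the set of infinite paths, identified with $\{0,1\}^{\mathbb N}$. $Aut(T)$ is the group of bijections of vertices preserving adjacency (hence levels); each induces a homeomorphism of $\partial T$. The Bernoulli measure $\mu_1$ gives each cylinder $[w_1\cdots w_i]$ mass $2^{-i}$. The adding machine $a$ is addition of $1$ with carry to the right: $a(0w_2\cdots)=1w_2\cdots$; if $w_1=\cdots=w_k=1$, $w_{k+1}=0$ then $a(w)=0^k1w_{k+2}\cdots$; $a(1^\infty)=0^\infty$. Rotated odometer: the von Neumann–Kakutani map $\mathfrak{a}:[0,1)\to[0,1)$ is $\mathfrak{a}(x)=x-(1-3\cdot2^{-n})$ for $x\in[1-2^{1-n},1-2^{-n})$, $n\ge1$; for $q\in\mathbb N$ and a permutation $\pi$ of $q$ symbols, $R_\pi$ translates $[k/q,(k+1)/q)$ onto $[\pi(k)/q,(\pi(k)+1)/q)$; $F_\pi=\mathfrak{a}\circ R_\pi$. *)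

theory Defs
  imports "HOL-Probability.Probability"
begin

text \<open>Vertices of the rooted binary tree: words over bool (False = 0, True = 1),
  the word w1...wi is the list [w1,...,wi]; its children are w @ [b].\<close>

definition tree_adj :: "bool list \<Rightarrow> bool list \<Rightarrow> bool" where
  "tree_adj u v \<longleftrightarrow> (\<exists>b. v = u @ [b]) \<or> (\<exists>b. u = v @ [b])"

definition tree_aut :: "(bool list \<Rightarrow> bool list) \<Rightarrow> bool" where
  "tree_aut f \<longleftrightarrow> bij f \<and> (\<forall>u v. tree_adj u v \<longleftrightarrow> tree_adj (f u) (f v))"

text \<open>Boundary: infinite paths = sequences nat => bool (index 0 = first letter w1).
  Induced action of a tree automorphism on the boundary.\<close>
definition tree_act :: "(bool list \<Rightarrow> bool list) \<Rightarrow> (nat \<Rightarrow> bool) \<Rightarrow> (nat \<Rightarrow> bool)" where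
  "tree_act f w = (\<lambda>i. f (map w [0..<Suc i]) ! i)"

definition adding_machine :: "(nat \<Rightarrow> bool) \<Rightarrow> (nat \<Rightarrow> bool)" where
  "adding_machine w = (\<lambda>i. if (\<forall>j<i. w j) then \<not> w i else w i)"

definition bernoulli_boundary :: "(nat \<Rightarrow> bool) measure" where
  "bernoulli_boundary = (\<Pi>\<^sub>M i\<in>(UNIV::nat set). measure_pmf (bernoulli_pmf (1/2)))"

definition boundary_top :: "(nat \<Rightarrow> bool) topology" where
  "boundary_top = product_topology (\<lambda>_. discrete_topology UNIV) UNIV"

abbreviation unit_lebesgue :: "real measure" where
  "unit_lebesgue \<equiv> lebesgue_on {0..<1}"

definition measure_preserving_map :: "'a measure \<Rightarrow> 'b measure \<Rightarrow> ('a \<Rightarrow> 'b) \<Rightarrow> bool" where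
  "measure_preserving_map M N f \<longleftrightarrow> f \<in> measurable M N \<and> distr M N f = N"

definition vnk_interval :: "nat \<Rightarrow> real set" where
  "vnk_interval n = {1 - 2 / 2 ^ n ..< 1 - 1 / 2 ^ n}"

definition vnk :: "real \<Rightarrow> real" where
  "vnk x = (if \<exists>n\<ge>1. x \<in> vnk_interval n
            then x - (1 - 3 / 2 ^ (THE n. n \<ge> 1 \<and> x \<in> vnk_interval n)) else x)"

definition rot_perm :: "nat \<Rightarrow> (nat \<Rightarrow> nat) \<Rightarrow> real \<Rightarrow> real" where
  "rot_perm q \<pi> x = (let k = nat \<lfloor>real q * x\<rfloor> in x + (real (\<pi> k) - real k) / real q)"

definition rotated_odometer :: "nat \<Rightarrow> (nat \<Rightarrow> nat) \<Rightarrow> real \<Rightarrow> real" where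
  "rotated_odometer q \<pi> = vnk \<circ> rot_perm q \<pi>"

definition cyc_orbit :: "('a \<Rightarrow> 'a) \<Rightarrow> 'a \<Rightarrow> 'a set" where
  "cyc_orbit h x = {(h ^^ n) x | n. True} \<union> {(inv h ^^ n) x | n. True}"

end

theory Submission
  imports Defs
begin

text \<open>The map \<open>\<phi>\<close> sends a real number to its binary digits: it conjugates the von
  Neumann--Kakutani map to the adding machine, and a permutation of the dyadic intervals of length
  \<open>2 ^ -m\<close> to a map changing only the first \<open>m\<close> digits. For the dynamics, put \<open>h = a \<circ> g\<close>. The cycles of
  \<open>h\<close> on level \<open>m\<close> have lengths \<open>2 ^ k\<close> with \<open>k \<le> m\<close>, and \<open>h\<close> changes the letters beyond level \<open>m\<close> only
  on the single cylinder that \<open>g\<close> maps to \<open>1 \<cdots> 1\<close>, where it applies \<open>a\<close> to them. Let \<open>U\<close> be the union of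
  the cylinders in the cycle of that cylinder. Outside \<open>U\<close> the first return to a cylinder is the
  identity, and inside \<open>U\<close> it is conjugate to the adding machine, which is minimal and of infinite
  order.\<close>

section \<open>Common prefixes of sequences and maps acting on levels\<close>

definition agree :: "nat \<Rightarrow> (nat \<Rightarrow> 'a) \<Rightarrow> (nat \<Rightarrow> 'a) \<Rightarrow> bool" where
  "agree n v w \<longleftrightarrow> (\<forall>i<n. v i = w i)"

lemma agree_refl [simp]: "agree n w w"
  by (simp add: agree_def)

lemma agree_0 [simp]: "agree 0 v w"
  by (simp add: agree_def)

lemma agree_sym: "agree n v w \<Longrightarrow> agree n w v"
  by (simp add: agree_def)

lemma agree_trans: "agree n u v \<Longrightarrow> agree n v w \<Longrightarrow> agree n u w"
  by (simp add: agree_def)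

lemma agree_mono: "agree n v w \<Longrightarrow> k \<le> n \<Longrightarrow> agree k v w"
  by (simp add: agree_def)

lemma agree_Suc: "agree (Suc n) v w \<longleftrightarrow> agree n v w \<and> v n = w n"
  by (auto simp: agree_def less_Suc_eq)

lemma agree_add: "agree (m + r) v w \<longleftrightarrow> agree m v w \<and> agree r (\<lambda>i. v (m + i)) (\<lambda>i. w (m + i))"
proof (induction r)
  case (Suc r)
  then show ?case by (auto simp: agree_Suc)
qed simp

text \<open>An isometry for the ultrametric given by the length of the common prefix: on each level
  the map is well defined and injective on words.\<close>

definition level_isometry :: "((nat \<Rightarrow> 'a) \<Rightarrow> (nat \<Rightarrow> 'a)) \<Rightarrow> bool" where
  "level_isometry h \<longleftrightarrow> (\<forall>n v w. agree n (h v) (h w) \<longleftrightarrow> agree n v w)"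

lemma level_isometryD: "level_isometry h \<Longrightarrow> agree n (h v) (h w) \<longleftrightarrow> agree n v w"
  by (simp add: level_isometry_def)

lemma level_isometry_comp: "level_isometry f \<Longrightarrow> level_isometry h \<Longrightarrow> level_isometry (f \<circ> h)"
  by (simp add: level_isometry_def)

lemma level_isometry_funpow: "level_isometry h \<Longrightarrow> level_isometry (h ^^ k)"
  by (induction k) (auto simp: level_isometry_def)

lemma agree_funpow_fixed:
  assumes "level_isometry h" "agree n (h w) w"
  shows "agree n ((h ^^ k) w) w"
proof (induction k)
  case (Suc k)
  then have "agree n (h ((h ^^ k) w)) (h w)"
    using assms(1) by (simp add: level_isometryD)
  then show ?case using assms(2) by (auto intro: agree_trans)
qed simp

text \<open>Induction on the level: a vertex has only two children, so in passing to the next level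
  the period either stays the same or doubles.\<close>

lemma level_period:
  fixes h :: "(nat \<Rightarrow> bool) \<Rightarrow> (nat \<Rightarrow> bool)"
  assumes h: "level_isometry h"
  shows "\<exists>k\<le>n. \<forall>j. agree n ((h ^^ j) w) w \<longleftrightarrow> 2 ^ k dvd j"
proof (induction n)
  case 0
  show ?case by (intro exI[of _ 0]) simp
next
  case (Suc n)
  then obtain k where k: "k \<le> n" "\<And>j. agree n ((h ^^ j) w) w \<longleftrightarrow> 2 ^ k dvd j"
    by blast
  define T where "T = h ^^ (2 ^ k)"
  have T: "level_isometry T"
    using h by (simp add: T_def level_isometry_funpow)
  have T_pow: "T ^^ q = h ^^ (2 ^ k * q)" for q
    by (simp add: T_def funpow_mult mult.commute)
  show ?case
  proof (cases "agree (Suc n) (T w) w")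
    case True
    have "agree (Suc n) ((h ^^ j) w) w \<longleftrightarrow> 2 ^ k dvd j" for j
    proof
      show "2 ^ k dvd j" if "agree (Suc n) ((h ^^ j) w) w"
        using that k(2) by (simp add: agree_Suc)
      show "agree (Suc n) ((h ^^ j) w) w" if "2 ^ k dvd j"
        using that agree_funpow_fixed[OF T True] by (auto simp: dvd_def T_pow)
    qed
    then show ?thesis using k(1) by (intro exI[of _ k]) auto
  next
    case False
    have Tn: "agree n (T w) w"
      using k(2)[of "2 ^ k"] by (simp add: T_def)
    then have "agree n (T (T w)) (T w)"
      using T by (simp add: level_isometryD)
    moreover have "\<not> agree (Suc n) (T (T w)) (T w)"
      using T False by (simp add: level_isometryD)
    ultimately have "T (T w) n \<noteq> T w n" "T w n \<noteq> w n" "agree n (T (T w)) w"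
      using False Tn agree_trans by (auto simp: agree_Suc)
    \<comment> \<open>\<open>T\<close> changes the boolean letter \<open>n\<close> twice in
      succession, and two such changes cancel.\<close>
    then have TT: "agree (Suc n) ((T ^^ 2) w) w"
      by (simp add: agree_Suc numeral_2_eq_2)
    have even_fixed: "agree (Suc n) ((T ^^ (2 * q)) w) w" for q
      using agree_funpow_fixed[OF level_isometry_funpow[OF T] TT, of q]
      by (simp add: funpow_mult mult.commute)
    have "agree (Suc n) ((h ^^ j) w) w \<longleftrightarrow> 2 ^ Suc k dvd j" for j
    proof
      assume a: "agree (Suc n) ((h ^^ j) w) w"
      then have "2 ^ k dvd j"
        using k(2) by (simp add: agree_Suc)
      then obtain q where q: "j = 2 ^ k * q" by blast
      have "even q"
      proof (rule ccontr)
        assume "odd q"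
        then obtain r where "q = Suc (2 * r)" by (auto elim!: oddE)
        then have "agree (Suc n) (T ((T ^^ (2 * r)) w)) w"
          using a q T_pow by (metis comp_apply funpow.simps(2))
        moreover have "agree (Suc n) (T ((T ^^ (2 * r)) w)) (T w)"
          using even_fixed T by (simp add: level_isometryD)
        ultimately show False
          using False agree_sym agree_trans by blast
      qed
      then show "2 ^ Suc k dvd j"
        using q by (auto elim!: evenE)
    next
      assume "2 ^ Suc k dvd j"
      then obtain q where "j = 2 ^ k * (2 * q)" by (auto simp: dvd_def)
      then show "agree (Suc n) ((h ^^ j) w) w"
        using even_fixed T_pow by metis
    qed
    then show ?thesis using k(1) by (intro exI[of _ "Suc k"]) auto
  qed
qed

section \<open>Tree automorphisms on the boundary\<close>

text \<open>Automorphisms preserve degrees, and the root has only two neighbours, whereas any other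
  vertex has a parent besides its two children.\<close>

lemma tree_aut_Nil:
  assumes "tree_aut f"
  shows "f [] = []"
proof (rule ccontr)
  assume "f [] \<noteq> []"
  then obtain u b where u: "f [] = u @ [b]"
    by (meson rev_exhaust)
  have f: "bij f" "\<And>u v. tree_adj (f u) (f v) \<longleftrightarrow> tree_adj u v"
    using assms by (auto simp: tree_aut_def)
  have "f ` {[True], [False]} = f ` {v. tree_adj [] v}"
    by (rule arg_cong[where f = "image f"]) (auto simp: tree_adj_def)
  also have "\<dots> = {v. tree_adj (f []) v}"
    using f by (auto simp: image_iff) (metis bij_pointE)
  also have "\<dots> \<supseteq> {u, f [] @ [True], f [] @ [False]}"
    by (auto simp: tree_adj_def u)
  finally have "card {u, f [] @ [True], f [] @ [False]} \<le> card (f ` {[True], [False]})"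
    by (intro card_mono) auto
  moreover have "card (f ` {[True], [False]}) \<le> 2"
    by (rule order.trans[OF card_image_le]) auto
  ultimately show False by (simp add: u)
qed

text \<open>The image of a child of \<open>u\<close> is adjacent to \<open>f u\<close>. It cannot be
  the parent of \<open>f u\<close>, because by induction that vertex is already the image of the
  parent of \<open>u\<close>.\<close>

lemma tree_aut_snoc:
  assumes "tree_aut f"
  shows "\<exists>c. f (u @ [b]) = f u @ [c]"
proof (induction u arbitrary: b rule: rev_induct)
  case Nil
  have "tree_adj (f []) (f [b])"
    using assms by (auto simp: tree_aut_def tree_adj_def)
  then show ?case using tree_aut_Nil[OF assms] by (auto simp: tree_adj_def)
next
  case (snoc d v)
  obtain e where e: "f (v @ [d]) = f v @ [e]" using snoc by blast
  have "f ((v @ [d]) @ [b]) \<noteq> f v"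
    using assms by (auto simp: tree_aut_def bij_def inj_eq)
  moreover have "tree_adj (f (v @ [d])) (f ((v @ [d]) @ [b]))"
    using assms by (auto simp: tree_aut_def tree_adj_def)
  ultimately show ?case by (auto simp: tree_adj_def e)
qed

lemma length_tree_aut: "tree_aut f \<Longrightarrow> length (f u) = length u"
proof (induction u rule: rev_induct)
  case (snoc b u)
  then show ?case using tree_aut_snoc[of f u b] by auto
qed (simp add: tree_aut_Nil)

text \<open>Images of prefixes are prefixes of one another, so the letters that
  \<open>tree_act\<close> reads off at separate levels fit together into one path.\<close>

lemma map_tree_act:
  assumes "tree_aut f"
  shows "map (tree_act f w) [0..<n] = f (map w [0..<n])"
proof (induction n)
  case (Suc n)
  obtain c where c: "f (map w [0..<n] @ [w n]) = f (map w [0..<n]) @ [c]"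
    using tree_aut_snoc[OF assms] by blast
  then have "tree_act f w n = c"
    using length_tree_aut[OF assms, of "map w [0..<n]"] by (simp add: tree_act_def nth_append)
  then show ?case using Suc c by simp
qed (simp add: tree_aut_Nil assms)

lemma agree_iff_map: "agree n v w \<longleftrightarrow> map v [0..<n] = map w [0..<n]"
  by (auto simp: agree_def)

lemma level_isometry_tree_act:
  assumes "tree_aut f"
  shows "level_isometry (tree_act f)"
  using assms unfolding level_isometry_def agree_iff_map
  by (simp add: map_tree_act tree_aut_def bij_def inj_eq)

lemma tree_aut_inv:
  assumes "tree_aut f"
  shows "tree_aut (inv f)"
  unfolding tree_aut_def
proof (intro conjI allI)
  have f: "bij f" "\<And>u v. tree_adj u v \<longleftrightarrow> tree_adj (f u) (f v)"
    using assms by (auto simp: tree_aut_def)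
  then show "bij (inv f)" by (simp add: bij_imp_bij_inv)
  show "tree_adj u v \<longleftrightarrow> tree_adj (inv f u) (inv f v)" for u v
    using f(2)[of "inv f u" "inv f v"] bij_is_surj[OF f(1)] by (simp add: surj_f_inv_f)
qed

lemma surj_tree_act:
  assumes "tree_aut f"
  shows "surj (tree_act f)"
proof (rule surjI)
  fix w
  have "surj f" using assms by (simp add: tree_aut_def bij_def)
  then have "map (tree_act f (tree_act (inv f) w)) [0..<n] = map w [0..<n]" for n
    by (simp add: map_tree_act assms tree_aut_inv surj_f_inv_f)
  then have "agree n (tree_act f (tree_act (inv f) w)) w" for n
    by (simp add: agree_iff_map)
  then show "tree_act f (tree_act (inv f) w) = w"
    by (auto simp: agree_def)
qed

section \<open>The adding machine\<close>

text \<open>Reading a sequence as a 2-adic integer, least significant digit first, turns the adding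
  machine into addition of 1.\<close>

primrec adic_val :: "(nat \<Rightarrow> bool) \<Rightarrow> nat \<Rightarrow> nat" where
  "adic_val w 0 = 0"
| "adic_val w (Suc n) = adic_val w n + (if w n then 2 ^ n else 0)"

lemma adic_val_less: "adic_val w n < 2 ^ n"
  by (induction n) auto

lemma adic_val_eq_iff: "adic_val v n = adic_val w n \<longleftrightarrow> agree n v w"
proof (induction n)
  case (Suc n)
  then show ?case
    using adic_val_less[of v n] adic_val_less[of w n] by (auto simp: agree_Suc)
qed simp

lemma adic_val_max: "adic_val w n + 1 = 2 ^ n \<longleftrightarrow> (\<forall>j<n. w j)"
proof (induction n)
  case (Suc n)
  then show ?case using adic_val_less[of w n] by (auto simp: less_Suc_eq simp flip: Suc_eq_plus1)
qed simp

text \<open>Induction on \<open>n\<close>: letter \<open>n\<close> flips exactly when all lower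
  letters are ones, which is when the residue modulo \<open>2 ^ n\<close> wraps around to 0.\<close>

lemma adic_val_adding_machine: "adic_val (adding_machine w) n = (adic_val w n + 1) mod 2 ^ n"
proof (induction n)
  case (Suc n)
  show ?case
  proof (cases "\<forall>j<n. w j")
    case True
    then have *: "adic_val w n + 1 = 2 ^ n" using adic_val_max by blast
    then have "adic_val (adding_machine w) n = 0" using Suc by simp
    moreover have "adic_val w (Suc n) + 1 = (if w n then 2 ^ Suc n else 2 ^ n)"
      using * by auto
    ultimately show ?thesis using True by (simp add: adding_machine_def)
  next
    case False
    then have "adic_val w n + 1 \<noteq> 2 ^ n"
      using adic_val_max by blast
    then have "adic_val w n + 1 < 2 ^ n"
      using adic_val_less[of w n] by linarith
    moreover have "adding_machine w n = w n"
      using False by (auto simp: adding_machine_def)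
    ultimately show ?thesis using Suc by simp
  qed
qed simp

lemma adic_val_adding_machine_funpow:
  "adic_val ((adding_machine ^^ q) w) n = (adic_val w n + q) mod 2 ^ n"
  by (induction q) (simp_all add: adic_val_less adic_val_adding_machine mod_Suc_eq)

lemma level_isometry_adding_machine: "level_isometry adding_machine"
proof -
  have "(Suc a mod 2 ^ n = Suc b mod 2 ^ n) = (a = b)" if "a < 2 ^ n" "b < 2 ^ n" for a b n :: nat
    using that by (auto simp: mod_Suc split: if_splits)
  then show ?thesis
    by (simp add: level_isometry_def adic_val_adding_machine adic_val_less flip: adic_val_eq_iff)
qed

lemma adding_machine_minimal: "\<exists>q. agree n ((adding_machine ^^ q) v) w"
proof -
  \<comment> \<open>The number of steps is the difference of the two residues; the summand
    \<open>2 ^ n\<close> keeps the subtraction within the naturals.\<close>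
  have "(adic_val v n + (2 ^ n - adic_val v n + adic_val w n)) mod 2 ^ n = adic_val w n"
    using adic_val_less[of v n] adic_val_less[of w n] by simp
  then show ?thesis
    by (metis adic_val_adding_machine_funpow adic_val_eq_iff)
qed

lemma adding_machine_funpow_neq: "q > 0 \<Longrightarrow> (adding_machine ^^ q) w \<noteq> w"
proof
  assume q: "q > 0" and eq: "(adding_machine ^^ q) w = w"
  have mod_neq: "(a + b) mod M \<noteq> a" if "a < M" "0 < b" "b < M" for a b M :: nat
    using that by (cases "a + b < M") (simp_all add: le_mod_geq)
  \<comment> \<open>Level \<open>q\<close> is deep enough to detect the motion, since
    \<open>0 < q < 2 ^ q\<close>.\<close>
  have "(adic_val w q + q) mod 2 ^ q = adic_val w q"
    using adic_val_adding_machine_funpow[of q w q] eq by simp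
  moreover have "(adic_val w q + q) mod 2 ^ q \<noteq> adic_val w q"
    by (rule mod_neq[OF adic_val_less q less_exp])
  ultimately show False by simp
qed

lemma surj_adding_machine: "surj adding_machine"
proof (rule surjI)
  fix w :: "nat \<Rightarrow> bool"
  \<comment> \<open>Subtraction of 1 with borrow: a letter flips as long as all letters before it
    are zeros.\<close>
  let ?v = "\<lambda>i. w i \<noteq> (\<forall>j<i. \<not> w j)"
  have "(\<forall>j<i. ?v j) \<longleftrightarrow> (\<forall>j<i. \<not> w j)" for i
  proof (induction i)
    case (Suc i)
    then show ?case unfolding All_less_Suc by metis
  qed simp
  then have "adding_machine ?v i = w i" for i
    unfolding adding_machine_def by presburger
  then show "adding_machine ?v = w" ..
qed

section \<open>The boundary topology\<close>

text \<open>Cylinders form a base: a basic open set of the product restricts finitely many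
  coordinates, hence contains the cylinder around each of its points at any level beyond
  them.\<close>

lemma openin_boundary_top_iff:
  "openin boundary_top S \<longleftrightarrow> (\<forall>x\<in>S. \<exists>n. \<forall>y. agree n y x \<longrightarrow> y \<in> S)"
proof
  assume S: "openin boundary_top S"
  show "\<forall>x\<in>S. \<exists>n. \<forall>y. agree n y x \<longrightarrow> y \<in> S"
  proof
    fix x assume x: "x \<in> S"
    have "\<forall>x\<in>S. \<exists>V. finite {i. V i \<noteq> UNIV} \<and> x \<in> Pi\<^sub>E UNIV V \<and> Pi\<^sub>E UNIV V \<subseteq> S"
      using S by (simp add: boundary_top_def openin_product_topology_alt)
    then obtain V where V: "finite {i. V i \<noteq> UNIV}" "x \<in> Pi\<^sub>E UNIV V" "Pi\<^sub>E UNIV V \<subseteq> S"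
      using x by blast
    obtain n where n: "\<And>i. V i \<noteq> UNIV \<Longrightarrow> i < n"
      using V(1) unfolding finite_nat_set_iff_bounded by blast
    have "y \<in> S" if "agree n y x" for y
    proof -
      have "y i \<in> V i" for i
        using that n[of i] V(2) unfolding agree_def by (cases "V i = UNIV") (auto simp: PiE_iff)
      then show ?thesis using V(3) by auto
    qed
    then show "\<exists>n. \<forall>y. agree n y x \<longrightarrow> y \<in> S" by blast
  qed
next
  assume S: "\<forall>x\<in>S. \<exists>n. \<forall>y. agree n y x \<longrightarrow> y \<in> S"
  have "\<exists>V. finite {i. V i \<noteq> UNIV} \<and> x \<in> Pi\<^sub>E UNIV V \<and> Pi\<^sub>E UNIV V \<subseteq> S" if "x \<in> S" for x
  proof -
    obtain n where n: "\<And>y. agree n y x \<Longrightarrow> y \<in> S" using bspec[OF S \<open>x \<in> S\<close>] by auto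
    let ?V = "\<lambda>i. if i < n then {x i} else UNIV"
    have "finite {i. ?V i \<noteq> UNIV}"
      by (rule finite_subset[of _ "{..<n}"]) (auto split: if_splits)
    moreover have "y \<in> S" if "y \<in> Pi\<^sub>E UNIV ?V" for y
    proof (rule n)
      have "y i \<in> ?V i" for i using that by (simp add: PiE_iff)
      then show "agree n y x" unfolding agree_def by (metis singletonD)
    qed
    moreover have "x \<in> Pi\<^sub>E UNIV ?V" by (simp add: PiE_iff)
    ultimately show ?thesis by (intro exI[of _ ?V] conjI subsetI)
  qed
  then show "openin boundary_top S"
    unfolding boundary_top_def openin_product_topology_alt by simp
qed

lemma topspace_boundary_top [simp]: "topspace boundary_top = UNIV"
  by (simp add: boundary_top_def)

lemma in_closure_of_boundary_topI:
  assumes "\<And>n. \<exists>z\<in>S. agree n z y"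
  shows "y \<in> boundary_top closure_of S"
  unfolding in_closure_of
proof (intro conjI allI impI)
  fix T assume "y \<in> T \<and> openin boundary_top T"
  then obtain n where "\<forall>z. agree n z y \<longrightarrow> z \<in> T"
    by (auto simp: openin_boundary_top_iff)
  then show "\<exists>z. z \<in> S \<and> z \<in> T" using assms[of n] by auto
qed simp

section \<open>Dynamics of the composition\<close>

text \<open>The properties of the boundary action on which the dynamics rests. Letters are numbered
  from 0, so \<open>i \<ge> m\<close> means the entries after the first \<open>m\<close>.\<close>

locale finitary_odometer =
  fixes G :: "(nat \<Rightarrow> bool) \<Rightarrow> (nat \<Rightarrow> bool)" and m :: nat
  assumes G_isometry: "level_isometry G"
    and G_surj: "surj G"
    and G_tail: "i \<ge> m \<Longrightarrow> G w i = w i"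
begin

definition h :: "(nat \<Rightarrow> bool) \<Rightarrow> (nat \<Rightarrow> bool)" where
  "h = adding_machine \<circ> G"

definition tail :: "(nat \<Rightarrow> bool) \<Rightarrow> (nat \<Rightarrow> bool)" where
  "tail w = (\<lambda>i. w (m + i))"

text \<open>The cylinder of level \<open>m\<close> on which the carry of the adding machine reaches the tail.\<close>

definition carry :: "(nat \<Rightarrow> bool) \<Rightarrow> bool" where
  "carry w \<longleftrightarrow> (\<forall>j<m. G w j)"

lemma h_isometry: "level_isometry h"
  by (simp add: h_def level_isometry_comp level_isometry_adding_machine G_isometry)

lemma h_surj: "surj h"
  unfolding h_def by (rule comp_surj[OF G_surj surj_adding_machine])

lemma agree_h_funpow [simp]: "agree n ((h ^^ k) v) ((h ^^ k) w) \<longleftrightarrow> agree n v w"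
  by (intro level_isometryD level_isometry_funpow h_isometry)

text \<open>The carry reaches position \<open>m + i\<close> iff the first \<open>m\<close> letters
  of \<open>G w\<close> and the first \<open>i\<close> letters of the tail are all ones.\<close>

lemma tail_h: "tail (h w) = (if carry w then adding_machine (tail w) else tail w)"
proof
  fix i
  have "(\<forall>j<m + i. G w j) \<longleftrightarrow> carry w \<and> (\<forall>j<i. w (m + j))"
    using agree_add[of m i "G w" "\<lambda>_. True"] by (auto simp: agree_def carry_def G_tail)
  then show "tail (h w) i = (if carry w then adding_machine (tail w) else tail w) i"
    by (auto simp: tail_def h_def adding_machine_def G_tail)
qed

lemma carry_cong: "agree m v w \<Longrightarrow> carry v \<longleftrightarrow> carry w"
  using level_isometryD[OF G_isometry, of m v w] by (auto simp: agree_def carry_def)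

text \<open>\<open>G\<close> is injective on words of length \<open>m\<close>, so only one of them
  is sent to the word of ones.\<close>

lemma carry_agree: "carry v \<Longrightarrow> carry w \<Longrightarrow> agree m v w"
  using level_isometryD[OF G_isometry, of m v w] by (auto simp: agree_def carry_def)

lemma carry_exists: "\<exists>w. carry w"
proof -
  obtain w where "G w = (\<lambda>_. True)" using surjD[OF G_surj] by metis
  then show ?thesis unfolding carry_def by (metis (full_types))
qed

lemma eq_if_agree_tail: "agree m v w \<Longrightarrow> tail v = tail w \<Longrightarrow> v = w"
proof
  fix i assume "agree m v w" "tail v = tail w"
  then show "v i = w i"
    using fun_cong[of "tail v" "tail w" "i - m"] unfolding agree_def tail_def
    by (cases "i < m") (simp_all only: not_less le_add_diff_inverse)
qed

text \<open>Along its cycle at level \<open>m\<close>, a point meets the carry cylinder only once, so the first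
  return map to that cylinder is the adding machine on the tails.\<close>

lemma carry_return:
  assumes "carry z"
  obtains p where "p > 0" "\<And>q. carry ((h ^^ (p * q)) z)"
    "\<And>q. tail ((h ^^ (p * q)) z) = (adding_machine ^^ q) (tail z)"
proof -
  have "\<exists>k. \<forall>j. agree m ((h ^^ j) z) z \<longleftrightarrow> 2 ^ k dvd j"
    using level_period[OF h_isometry] by blast
  then obtain k where k: "\<And>j. agree m ((h ^^ j) z) z \<longleftrightarrow> 2 ^ k dvd j" by blast
  define p :: nat where "p = 2 ^ k"
  have p: "p > 0" by (simp add: p_def)
  have "agree m ((h ^^ (p * q)) z) z" for q
    using k by (simp add: p_def)
  then have cr: "carry ((h ^^ (p * q)) z)" for q
    using assms carry_cong by blast
  have step: "tail ((h ^^ p) w) = adding_machine (tail w)" if w: "carry w" for w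
  proof -
    \<comment> \<open>The first step applies the adding machine to the tail. The other
      \<open>p - 1\<close> steps start outside the carry cylinder, because \<open>w\<close> follows
      \<open>z\<close> at level \<open>m\<close> and \<open>z\<close> returns only at multiples of
      \<open>p\<close>.\<close>
    have "s \<le> p \<Longrightarrow> s > 0 \<Longrightarrow> tail ((h ^^ s) w) = adding_machine (tail w)" for s
    proof (induction s)
      case (Suc s)
      show ?case
      proof (cases "s = 0")
        case False
        then have "\<not> p dvd s" using Suc.prems by (auto dest: dvd_imp_le)
        then have "\<not> agree m ((h ^^ s) z) z" using k by (simp add: p_def)
        then have "\<not> carry ((h ^^ s) z)" using assms carry_agree by blast
        moreover have "agree m ((h ^^ s) w) ((h ^^ s) z)"
          using carry_agree w assms by simp
        ultimately have "\<not> carry ((h ^^ s) w)" using carry_cong by blast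
        then show ?thesis using Suc False by (simp add: tail_h)
      qed (simp add: tail_h w)
    qed simp
    then show ?thesis using p by blast
  qed
  have "tail ((h ^^ (p * q)) z) = (adding_machine ^^ q) (tail z)" for q
  proof (induction q)
    case (Suc q)
    have "(h ^^ (p * Suc q)) z = (h ^^ p) ((h ^^ (p * q)) z)"
      by (simp add: funpow_add)
    then show ?case using step[OF cr] Suc by simp
  qed simp
  then show ?thesis using that p cr by blast
qed

lemma infinite_order: "n > 0 \<Longrightarrow> h ^^ n \<noteq> id"
proof
  assume n: "n > 0" and eq: "h ^^ n = id"
  obtain z where "carry z" using carry_exists by blast
  then obtain p where "\<And>q. tail ((h ^^ (p * q)) z) = (adding_machine ^^ q) (tail z)"
    using carry_return by metis
  \<comment> \<open>The exponent \<open>p * n\<close> is a multiple of \<open>n\<close>, so this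
    iterate is the identity.\<close>
  from this[of n] have "(adding_machine ^^ n) (tail z) = tail z"
    using eq by (metis funpow_mult id_apply id_funpow mult.commute)
  then show False using n adding_machine_funpow_neq by blast
qed

text \<open>\<open>h\<close> permutes the words of level \<open>m\<close>, so a word leads forward
  to the carry cylinder iff it lies in the cycle of that cylinder.\<close>

definition U :: "(nat \<Rightarrow> bool) set" where
  "U = {w. \<exists>j. carry ((h ^^ j) w)}"

lemma U_cong: "agree m v w \<Longrightarrow> v \<in> U \<longleftrightarrow> w \<in> U"
proof -
  assume "agree m v w"
  then have "carry ((h ^^ j) v) \<longleftrightarrow> carry ((h ^^ j) w)" for j
    by (intro carry_cong) simp
  then show ?thesis by (simp add: U_def)
qed

text \<open>Both \<open>U\<close> and its complement are unions of cylinders of level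
  \<open>m\<close>.\<close>

lemma U_clopen: "openin boundary_top U" "closedin boundary_top U"
proof -
  have "openin boundary_top S" if "S \<in> {U, - U}" for S
    unfolding openin_boundary_top_iff
  proof (intro ballI exI allI impI)
    fix x y assume "x \<in> S" "agree m y x"
    then show "y \<in> S" using that U_cong[of y x] by auto
  qed
  then show "openin boundary_top U" "closedin boundary_top U"
    by (simp_all add: closedin_def Compl_eq_Diff_UNIV)
qed

lemma U_nonempty: "U \<noteq> {}"
proof -
  obtain w where "carry w" using carry_exists by blast
  then have "carry ((h ^^ 0) w)" by simp
  then show ?thesis unfolding U_def by blast
qed

lemma h_in_U_iff: "h w \<in> U \<longleftrightarrow> w \<in> U"
proof
  assume "h w \<in> U"
  then obtain j where "carry ((h ^^ j) (h w))" by (auto simp: U_def)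
  then have "carry ((h ^^ Suc j) w)" by (simp add: funpow_swap1)
  then show "w \<in> U" unfolding U_def by blast
next
  assume "w \<in> U"
  then obtain j where j: "carry ((h ^^ j) w)" by (auto simp: U_def)
  obtain k where "agree m ((h ^^ (2 ^ k)) w) w"
    using level_period[OF h_isometry, of m w] by (meson dvd_refl)
  \<comment> \<open>Adding a full period at level \<open>m\<close> postpones the visit by at least
    one step, which covers the case \<open>j = 0\<close>.\<close>
  then have "agree m ((h ^^ j) ((h ^^ (2 ^ k)) w)) ((h ^^ j) w)" by simp
  then have *: "carry ((h ^^ j) ((h ^^ (2 ^ k)) w))" using j carry_cong by blast
  obtain p :: nat where "2 ^ k = Suc p"
    using not0_implies_Suc[of "2 ^ k"] by auto
  then have "carry ((h ^^ (j + p)) (h w))"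
    using * by (simp add: funpow_add funpow_swap1)
  then show "h w \<in> U" unfolding U_def by blast
qed

lemma h_image_U: "h ` U = U"
proof
  show "h ` U \<subseteq> U" by (auto simp: h_in_U_iff)
  show "U \<subseteq> h ` U"
  proof
    fix u assume "u \<in> U"
    moreover obtain v where "u = h v" using surjD[OF h_surj] by blast
    ultimately show "u \<in> h ` U" by (simp add: h_in_U_iff)
  qed
qed

text \<open>Move \<open>x\<close> and \<open>y\<close> forward into the carry cylinder. There the
  return map is the adding machine on tails, which brings \<open>x\<close> close to the iterate of
  \<open>y\<close>; periodicity at level \<open>n\<close> then leads back to
  \<open>y\<close>.\<close>

lemma U_minimal:
  assumes "x \<in> U" "y \<in> U"
  shows "\<exists>t. agree n ((h ^^ t) x) y"
proof -
  obtain i j where i: "carry ((h ^^ i) y)" and j: "carry ((h ^^ j) x)"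
    using assms by (auto simp: U_def)
  obtain p where p: "\<And>q. carry ((h ^^ (p * q)) ((h ^^ j) x))"
    "\<And>q. tail ((h ^^ (p * q)) ((h ^^ j) x)) = (adding_machine ^^ q) (tail ((h ^^ j) x))"
    using carry_return[OF j] by metis
  obtain q where q: "agree n ((adding_machine ^^ q) (tail ((h ^^ j) x))) (tail ((h ^^ i) y))"
    using adding_machine_minimal by blast
  have "agree (m + n) ((h ^^ (p * q)) ((h ^^ j) x)) ((h ^^ i) y)"
    using carry_agree[OF p(1) i] q p(2)[of q] unfolding agree_add by (simp add: tail_def)
  then have eq: "agree n ((h ^^ (p * q + j)) x) ((h ^^ i) y)"
    by (auto simp: funpow_add intro: agree_mono)
  obtain k where k: "\<And>s. agree n ((h ^^ s) y) y \<longleftrightarrow> 2 ^ k dvd s"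
    using level_period[OF h_isometry, of n y] by blast
  \<comment> \<open>Modulo the period of \<open>y\<close> at level \<open>n\<close>, running
    \<open>s\<close> steps forward undoes the \<open>i\<close> steps.\<close>
  define s where "s = 2 ^ k * i - i"
  have "s + i = 2 ^ k * i" by (simp add: s_def)
  then have "agree n ((h ^^ s) ((h ^^ i) y)) y"
    using k[of "2 ^ k * i"] by (metis comp_apply dvd_triv_left funpow_add)
  moreover have "agree n ((h ^^ s) ((h ^^ (p * q + j)) x)) ((h ^^ s) ((h ^^ i) y))"
    using eq by simp
  ultimately have "agree n ((h ^^ (s + (p * q + j))) x) y"
    by (metis agree_trans comp_apply funpow_add)
  then show ?thesis by blast
qed

text \<open>The orbit never meets the carry cylinder, so the tail stays constant and the period is
  that of the word at level \<open>m\<close>.\<close>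

lemma periodic_outside_U:
  assumes "x \<notin> U"
  shows "\<exists>k\<le>m. (h ^^ (2 ^ k)) x = x \<and> (\<forall>j. 0 < j \<and> j < 2 ^ k \<longrightarrow> (h ^^ j) x \<noteq> x)"
proof -
  obtain k where k: "k \<le> m" "\<And>j. agree m ((h ^^ j) x) x \<longleftrightarrow> 2 ^ k dvd j"
    using level_period[OF h_isometry, of m x] by blast
  have "\<not> carry ((h ^^ j) x)" for j
    using assms by (auto simp: U_def)
  then have "tail ((h ^^ j) x) = tail x" for j
    by (induction j) (simp_all add: tail_h)
  then have "(h ^^ (2 ^ k)) x = x"
    using k(2)[of "2 ^ k"] by (simp add: eq_if_agree_tail)
  moreover have "(h ^^ j) x \<noteq> x" if "0 < j" "j < 2 ^ k" for j
    using k(2)[of j] that by (auto dest: dvd_imp_le)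
  ultimately show ?thesis using k(1) by (intro exI[of _ k]) simp
qed

end

section \<open>Binary digits\<close>

text \<open>Taking floors selects the expansion ending in zeros for dyadic rationals. Digit
  \<open>i\<close> has weight \<open>1 / 2 ^ Suc i\<close>.\<close>

definition binary_digits :: "real \<Rightarrow> nat \<Rightarrow> bool" where
  "binary_digits x = (\<lambda>i. odd \<lfloor>2 ^ Suc i * x\<rfloor>)"

text \<open>In contrast to \<open>adic_val\<close>, the first digit is the most significant one here.\<close>

primrec prefix_val :: "(nat \<Rightarrow> bool) \<Rightarrow> nat \<Rightarrow> nat" where
  "prefix_val w 0 = 0"
| "prefix_val w (Suc n) = 2 * prefix_val w n + of_bool (w n)"

lemma prefix_val_less: "prefix_val w n < 2 ^ n"
  by (induction n) auto

lemma real_prefix_val_le: "real (prefix_val w n) + 1 \<le> 2 ^ n"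
  using of_nat_mono[OF Suc_leI[OF prefix_val_less[of w n]], where 'a = real]
  by (simp add: add.commute)

lemma prefix_val_eq_iff: "prefix_val v n = prefix_val w n \<longleftrightarrow> agree n v w"
proof (induction n)
  case (Suc n)
  have "2 * a + of_bool p = 2 * b + of_bool q \<longleftrightarrow> a = b \<and> (p \<longleftrightarrow> q)" for a b :: nat and p q
    by (cases p; cases q) (simp_all, presburger+)
  then show ?case using Suc by (simp add: agree_Suc)
qed simp

lemma floor_double: "\<lfloor>2 * x\<rfloor> = 2 * \<lfloor>x\<rfloor> + of_bool (odd \<lfloor>2 * x\<rfloor>)" for x :: real
proof -
  have "\<lfloor>2 * x\<rfloor> = 2 * \<lfloor>x\<rfloor> \<or> \<lfloor>2 * x\<rfloor> = 2 * \<lfloor>x\<rfloor> + 1"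
    by linarith
  then show ?thesis by auto
qed

lemma prefix_val_binary_digits:
  assumes "x \<in> {0..<1}"
  shows "int (prefix_val (binary_digits x) n) = \<lfloor>2 ^ n * x\<rfloor>"
proof (induction n)
  case 0
  then show ?case using assms by (simp add: floor_unique)
next
  case (Suc n)
  then show ?case
    using floor_double[of "2 ^ n * x"] by (simp add: binary_digits_def mult.assoc)
qed

lemma agree_binary_digits_iff:
  assumes "x \<in> {0..<1}" "y \<in> {0..<1}"
  shows "agree n (binary_digits x) (binary_digits y) \<longleftrightarrow> \<lfloor>2 ^ n * x\<rfloor> = \<lfloor>2 ^ n * y\<rfloor>"
  using assms by (simp flip: prefix_val_eq_iff prefix_val_binary_digits)

lemma inj_on_binary_digits: "inj_on binary_digits {0..<1}"
proof (rule inj_onI, rule ccontr)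
  fix x y assume *: "x \<in> {0..<1}" "y \<in> {0..<1}" "binary_digits x = binary_digits y" "x \<noteq> y"
  \<comment> \<open>A level whose dyadic intervals are shorter than the distance between
    \<open>x\<close> and \<open>y\<close>.\<close>
  obtain n where n: "(1 / 2) ^ n < \<bar>x - y\<bar>"
    using real_arch_pow_inv[of "\<bar>x - y\<bar>" "1 / 2"] * by auto
  have "\<lfloor>2 ^ n * x\<rfloor> = \<lfloor>2 ^ n * y\<rfloor>"
    using agree_binary_digits_iff[of x y n] * by simp
  then have "\<bar>2 ^ n * x - 2 ^ n * y\<bar> < 1"
    by linarith
  then have "2 ^ n * \<bar>x - y\<bar> < 1"
    by (simp add: abs_mult flip: right_diff_distrib)
  then show False using n by (simp add: field_simps)
qed

text \<open>A translation by \<open>c / 2 ^ n\<close> changes the floors behind the digits from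
  \<open>n\<close> on by even integers. Both the von Neumann--Kakutani map and
  \<open>rot_perm\<close> are piecewise translations of this kind.\<close>

lemma binary_digits_dyadic_shift:
  assumes "x \<in> {0..<1}" "y \<in> {0..<1}" "2 ^ n * y = 2 ^ n * x + of_int c"
  shows "i \<ge> n \<Longrightarrow> binary_digits y i = binary_digits x i"
    and "int (prefix_val (binary_digits y) n) = int (prefix_val (binary_digits x) n) + c"
proof -
  show "binary_digits y i = binary_digits x i" if "i \<ge> n"
  proof -
    have e: "(2::real) ^ Suc i = 2 * 2 ^ (i - n) * 2 ^ n"
      using that by (simp flip: power_add)
    have "2 ^ Suc i * y = 2 * 2 ^ (i - n) * (2 ^ n * y)"
      unfolding e by (simp only: mult.assoc)
    then have "2 ^ Suc i * y = 2 ^ Suc i * x + of_int (2 * 2 ^ (i - n) * c)"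
      unfolding assms(3) e by (simp add: algebra_simps)
    then have "\<lfloor>2 ^ Suc i * y\<rfloor> = \<lfloor>2 ^ Suc i * x\<rfloor> + 2 * 2 ^ (i - n) * c"
      by (simp only: floor_add_int)
    then show ?thesis unfolding binary_digits_def by simp
  qed
  show "int (prefix_val (binary_digits y) n) = int (prefix_val (binary_digits x) n) + c"
    using assms by (simp only: prefix_val_binary_digits floor_add_int)
qed

section \<open>The von Neumann--Kakutani map as the adding machine on digits\<close>

text \<open>For \<open>n \<ge> 1\<close> the value \<open>2 ^ n - 2\<close> is the word of
  \<open>n - 1\<close> ones followed by a zero, so the interval records the position of the first
  zero digit.\<close>

lemma vnk_interval_iff: "x \<in> vnk_interval n \<longleftrightarrow> \<lfloor>2 ^ n * x\<rfloor> = 2 ^ n - 2"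
proof -
  have "\<lfloor>2 ^ n * x\<rfloor> = 2 ^ n - 2 \<longleftrightarrow> 2 ^ n - 2 \<le> 2 ^ n * x \<and> 2 ^ n * x < 2 ^ n - 1"
    unfolding floor_eq_iff by simp
  also have "\<dots> \<longleftrightarrow> x \<in> vnk_interval n"
    by (simp add: vnk_interval_def field_simps)
  finally show ?thesis ..
qed

lemma vnk_interval_unique:
  assumes "x \<in> vnk_interval k" "x \<in> vnk_interval n"
  shows "k = n"
proof -
  have False if "x \<in> vnk_interval k" "x \<in> vnk_interval n" "k < n" for k n
  proof -
    have "2 ^ Suc k \<le> (2::real) ^ n" using that(3) by (intro power_increasing) auto
    then have "1 - 1 / 2 ^ k \<le> 1 - 2 / (2::real) ^ n" by (simp add: field_simps)
    then show False using that by (auto simp: vnk_interval_def)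
  qed
  then show ?thesis using assms by (metis linorder_neqE_nat)
qed

lemma vnk_interval_exists:
  assumes "x \<in> {0..<1}"
  shows "\<exists>n\<ge>1. x \<in> vnk_interval n"
proof -
  have ex: "\<exists>n. x < 1 - 1 / 2 ^ n"
    using real_arch_pow_inv[of "1 - x" "1 / 2"] assms by (auto simp: field_simps)
  define n where "n = (LEAST n. x < 1 - 1 / 2 ^ n)"
  have n: "x < 1 - 1 / 2 ^ n" unfolding n_def by (rule LeastI_ex[OF ex])
  with assms have "n \<noteq> 0" by (intro notI) simp
  then obtain k where k: "n = Suc k" using not0_implies_Suc by blast
  \<comment> \<open>Minimality yields the left endpoint, as \<open>1 - 1 / 2 ^ k\<close> equals
    \<open>1 - 2 / 2 ^ n\<close>.\<close>
  have "\<not> x < 1 - 1 / 2 ^ k"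
    using not_less_Least[of k "\<lambda>n. x < 1 - 1 / 2 ^ n"] k by (simp add: n_def)
  then show ?thesis using n k by (intro exI[of _ n]) (simp add: vnk_interval_def)
qed

lemma vnk_eq:
  assumes "n \<ge> 1" "x \<in> vnk_interval n"
  shows "vnk x = x - (1 - 3 / 2 ^ n)"
proof -
  have "(THE n. n \<ge> 1 \<and> x \<in> vnk_interval n) = n"
    using assms vnk_interval_unique by (intro the_equality) auto
  then show ?thesis using assms by (auto simp: vnk_def)
qed

lemma prefix_val_ones: "prefix_val (\<lambda>_. True) n + 1 = 2 ^ n"
  by (induction n) simp_all

lemma prefix_val_zeros: "prefix_val (\<lambda>_. False) n = 0"
  by (induction n) auto

text \<open>On \<open>vnk_interval (Suc k)\<close> the digits begin with \<open>k\<close> ones and a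
  zero. The translation turns them into \<open>k\<close> zeros and a one and keeps all later digits,
  which is the carry rule.\<close>

lemma binary_digits_vnk:
  assumes x: "x \<in> {0..<1}"
  shows "binary_digits (vnk x) = adding_machine (binary_digits x)"
proof -
  obtain k where k: "x \<in> vnk_interval (Suc k)"
    using vnk_interval_exists[OF x] by (metis Suc_le_D One_nat_def)
  let ?n = "Suc k" and ?y = "vnk x"
  have y: "?y = x - (1 - 3 / 2 ^ ?n)"
    using vnk_eq[OF _ k] by simp
  have "1 - 2 / 2 ^ ?n \<le> x" "x < 1 - 1 / 2 ^ ?n"
    using k by (auto simp: vnk_interval_def)
  moreover have "(2::real) \<le> 2 ^ ?n" by simp
  then have "2 / 2 ^ ?n \<le> (1::real)" by simp
  moreover have "3 / 2 ^ ?n = 2 / 2 ^ ?n + (1 / 2 ^ ?n :: real)"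
    by (simp only: add_divide_distrib[symmetric]) simp
  moreover have "0 < (1 / 2 ^ ?n :: real)" by simp
  moreover have "2 / 2 ^ ?n = 2 * (1 / 2 ^ ?n :: real)" by simp
  ultimately have y01: "?y \<in> {0..<1}" unfolding y atLeastLessThan_iff by linarith
  \<comment> \<open>In units of \<open>1 / 2 ^ ?n\<close> the translation is by
    \<open>3 - 2 ^ ?n\<close>, which takes the prefix value \<open>2 ^ ?n - 2\<close> to 1.\<close>
  have "2 ^ ?n * ?y = 2 ^ ?n * x + of_int (3 - 2 ^ ?n)"
    unfolding y by (simp add: field_simps)
  note shift = binary_digits_dyadic_shift[OF x y01 this]
  have px: "int (prefix_val (binary_digits x) ?n) = 2 ^ ?n - 2"
    using k x by (simp only: prefix_val_binary_digits vnk_interval_iff)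
  then have "int (prefix_val (binary_digits ?y) ?n) = 1"
    using shift(2) by simp
  moreover have "prefix_val (\<lambda>i. i = k) ?n = 1"
    using prefix_val_eq_iff[of "\<lambda>i. i = k" k "\<lambda>_. False"]
    by (simp add: agree_def prefix_val_zeros)
  ultimately have "prefix_val (binary_digits ?y) ?n = prefix_val (\<lambda>i. i = k) ?n"
    by linarith
  then have dy: "agree ?n (binary_digits ?y) (\<lambda>i. i = k)"
    by (simp only: prefix_val_eq_iff)
  have "prefix_val (\<lambda>i. i < k) k + 1 = 2 ^ k"
    unfolding prefix_val_ones[symmetric, of k] by (simp add: prefix_val_eq_iff agree_def)
  then have "int (prefix_val (\<lambda>i. i < k) k) + 1 = 2 ^ k"
    by (metis of_nat_1 of_nat_add of_nat_numeral of_nat_power)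
  then have "int (prefix_val (\<lambda>i. i < k) ?n) = 2 ^ ?n - 2"
    by simp
  then have "prefix_val (binary_digits x) ?n = prefix_val (\<lambda>i. i < k) ?n"
    using px by linarith
  then have dx: "agree ?n (binary_digits x) (\<lambda>i. i < k)"
    by (simp only: prefix_val_eq_iff)
  show ?thesis
  proof
    fix i
    consider "i < k" | "i = k" | "i > k" by linarith
    then show "binary_digits ?y i = adding_machine (binary_digits x) i"
    proof cases
      case 3
      then have "\<exists>j<i. \<not> binary_digits x j" using dx by (auto simp: agree_def)
      then show ?thesis using 3 shift(1)[of i] by (simp add: adding_machine_def)
    qed (use dx dy in \<open>auto simp: agree_def adding_machine_def\<close>)
  qed
qed

section \<open>The permutation of dyadic intervals induced by a map of sequences\<close>

lemma binary_digits_of_prefix: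
  assumes "k < 2 ^ m"
  shows "prefix_val (binary_digits (real k / 2 ^ m)) m = k"
proof -
  have "real k / 2 ^ m \<in> {0..<1}"
    using of_nat_less_iff[of k "2 ^ m", where 'a = real] assms by simp
  from prefix_val_binary_digits[OF this, of m] show ?thesis by simp
qed

text \<open>The left endpoint of the interval with number \<open>k\<close> represents its word of
  length \<open>m\<close>. The identity beyond \<open>2 ^ m\<close> is what \<open>permutes\<close>
  demands.\<close>

definition prefix_perm :: "((nat \<Rightarrow> bool) \<Rightarrow> (nat \<Rightarrow> bool)) \<Rightarrow> nat \<Rightarrow> nat \<Rightarrow> nat" where
  "prefix_perm G m k =
     (if k < 2 ^ m then prefix_val (G (binary_digits (real k / 2 ^ m))) m else k)"

text \<open>The choice of representative is immaterial, since the first \<open>m\<close> letters of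
  \<open>G w\<close> depend only on those of \<open>w\<close>.\<close>

lemma prefix_perm_prefix_val:
  assumes "level_isometry G"
  shows "prefix_perm G m (prefix_val w m) = prefix_val (G w) m"
proof -
  have "agree m (binary_digits (real (prefix_val w m) / 2 ^ m)) w"
    using binary_digits_of_prefix[OF prefix_val_less] by (simp flip: prefix_val_eq_iff)
  then have "agree m (G (binary_digits (real (prefix_val w m) / 2 ^ m))) (G w)"
    using assms by (simp add: level_isometryD)
  then show ?thesis
    using prefix_val_less by (simp add: prefix_perm_def prefix_val_eq_iff)
qed

lemma prefix_perm_permutes:
  assumes "level_isometry G"
  shows "prefix_perm G m permutes {..<2 ^ m}"
proof (rule bij_imp_permutes)
  show "bij_betw (prefix_perm G m) {..<2 ^ m} {..<2 ^ m}"
    unfolding bij_betw_def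
  proof (intro conjI endo_inj_surj)
    show inj: "inj_on (prefix_perm G m) {..<2 ^ m}"
    proof (rule inj_onI)
      fix k l assume kl: "k \<in> {..<2 ^ m}" "l \<in> {..<2 ^ m}" "prefix_perm G m k = prefix_perm G m l"
      then have "agree m (binary_digits (real k / 2 ^ m)) (binary_digits (real l / 2 ^ m))"
        using assms by (simp add: prefix_perm_def prefix_val_eq_iff level_isometryD)
      then have "prefix_val (binary_digits (real k / 2 ^ m)) m = prefix_val (binary_digits (real l / 2 ^ m)) m"
        by (simp only: prefix_val_eq_iff)
      then show "k = l"
        using kl by (simp add: binary_digits_of_prefix)
    qed
    show "inj_on (prefix_perm G m) {..<2 ^ m}" by (fact inj)
    show "prefix_perm G m ` {..<2 ^ m} \<subseteq> {..<2 ^ m}"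
      using prefix_val_less by (auto simp: prefix_perm_def)
  qed simp
qed (simp add: prefix_perm_def)

text \<open>The translation replaces the prefix value \<open>k\<close> of \<open>x\<close> by the
  value \<open>l\<close> of its image under \<open>G\<close>; beyond level \<open>m\<close> neither
  the translation nor \<open>G\<close> changes a digit.\<close>

lemma rot_perm_binary_digits:
  assumes G: "level_isometry G" "\<And>i w. i \<ge> m \<Longrightarrow> G w i = w i" and x: "x \<in> {0..<1}"
  defines "y \<equiv> rot_perm (2 ^ m) (prefix_perm G m) x"
  shows "y \<in> {0..<1}" "binary_digits y = G (binary_digits x)"
proof -
  define k l where "k = prefix_val (binary_digits x) m" and "l = prefix_val (G (binary_digits x)) m"
  have fl: "\<lfloor>2 ^ m * x\<rfloor> = int k"
    using prefix_val_binary_digits[OF x] by (simp add: k_def)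
  then have "y = x + (real l - real k) / 2 ^ m"
    using prefix_perm_prefix_val[OF G(1)] by (simp add: y_def rot_perm_def Let_def k_def l_def)
  then have y: "2 ^ m * y = 2 ^ m * x + of_int (int l - int k)"
    by (simp add: field_simps)
  have "real k \<le> 2 ^ m * x" "2 ^ m * x < real k + 1"
    using fl by linarith+
  moreover have "real l + 1 \<le> 2 ^ m"
    unfolding l_def by (rule real_prefix_val_le)
  ultimately have "0 \<le> 2 ^ m * y" "2 ^ m * y < 2 ^ m * 1"
    using y by simp_all
  then show y01: "y \<in> {0..<1}"
    using mult_le_cancel_left_pos[of "2 ^ m" 0 y] by simp
  note shift = binary_digits_dyadic_shift[OF x y01 y]
  have "prefix_val (binary_digits y) m = l"
    using shift(2) by (simp add: k_def)
  then have "agree m (binary_digits y) (G (binary_digits x))"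
    by (simp add: l_def prefix_val_eq_iff)
  then show "binary_digits y = G (binary_digits x)"
    using shift(1) G(2) unfolding agree_def fun_eq_iff by (metis not_less)
qed

section \<open>Measure preservation\<close>

lemma measurable_binary_digits: "binary_digits \<in> measurable unit_lebesgue bernoulli_boundary"
  unfolding bernoulli_boundary_def
proof (rule measurable_PiM_single')
  fix i :: nat
  have "(\<lambda>x::real. odd \<lfloor>2 ^ Suc i * x\<rfloor>) \<in> measurable lborel (count_space UNIV)"
    by measurable
  then have "(\<lambda>x. binary_digits x i) \<in> measurable lebesgue (count_space UNIV)"
    unfolding binary_digits_def by (rule measurable_completion)
  then show "(\<lambda>x. binary_digits x i) \<in> measurable unit_lebesgue (measure_pmf (bernoulli_pmf (1 / 2)))"
    by (simp add: measurable_restrict_space1 cong: measurable_cong_sets)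
qed auto

text \<open>The preimage of a cylinder of level \<open>n\<close> is a dyadic interval of length
  \<open>1 / 2 ^ n\<close>.\<close>

lemma emeasure_cylinder:
  "emeasure unit_lebesgue {x \<in> {0..<1}. agree n (binary_digits x) w} = ennreal (1 / 2 ^ n)"
proof -
  let ?k = "real (prefix_val w n)"
  have "?k + 1 \<le> 2 ^ n"
    by (rule real_prefix_val_le)
  then have k: "(?k + 1) / 2 ^ n \<le> 1" by (simp add: field_simps)
  have "agree n (binary_digits x) w \<longleftrightarrow> x \<in> {?k / 2 ^ n ..< (?k + 1) / 2 ^ n}" if "x \<in> {0..<1}" for x
  proof -
    have "agree n (binary_digits x) w \<longleftrightarrow> \<lfloor>2 ^ n * x\<rfloor> = int (prefix_val w n)"
      by (simp flip: prefix_val_eq_iff prefix_val_binary_digits[OF that])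
    then show ?thesis by (simp add: floor_eq_iff field_simps)
  qed
  moreover have "{?k / 2 ^ n ..< (?k + 1) / 2 ^ n} \<subseteq> {0..<1}"
    using k by (auto intro: order.trans[rotated])
  ultimately have "{x \<in> {0..<1}. agree n (binary_digits x) w} = {?k / 2 ^ n ..< (?k + 1) / 2 ^ n}"
    by blast
  then show ?thesis
    using \<open>_ \<subseteq> {0..<1}\<close> by (simp add: emeasure_restrict_space divide_right_mono flip: diff_divide_distrib)
qed

lemma emeasure_bernoulli_half:
  "emeasure (measure_pmf (bernoulli_pmf (1 / 2))) A = ennreal (real (card A) / 2)"
  by (simp add: measure_pmf.emeasure_eq_measure measure_measure_pmf_finite pmf_bernoulli_half)

text \<open>A finite measure on the product is determined by the sets that restrict finitely many
  coordinates. The preimage of such a set is a disjoint union of dyadic intervals, which are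
  counted.\<close>

lemma distr_binary_digits: "distr unit_lebesgue bernoulli_boundary binary_digits = bernoulli_boundary"
  unfolding bernoulli_boundary_def
proof (rule measure_eqI_PiM_infinite)
  let ?B = "measure_pmf (bernoulli_pmf (1 / 2))"
  let ?P = "\<Pi>\<^sub>M i\<in>(UNIV::nat set). ?B"
  interpret product_prob_space "\<lambda>_::nat. ?B" UNIV ..
  fix A :: "nat \<Rightarrow> bool set" and J :: "nat set"
  assume J: "finite J"
  \<comment> \<open>Padding with \<open>UNIV\<close> places a condition on every coordinate below
    \<open>n\<close>, so that words of one common length \<open>n\<close> can be counted.\<close>
  define F where "F = (\<lambda>i. if i \<in> J then A i else UNIV)"
  obtain n where n: "J \<subseteq> {..<n}" using J finite_nat_iff_bounded by blast
  let ?W = "Pi\<^sub>E {..<n} F"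
  let ?C = "\<lambda>w. {x \<in> {0..<1}. agree n (binary_digits x) w}"
  have fin: "finite ?W" by (intro finite_PiE) auto
  have emb: "prod_emb UNIV (\<lambda>_. ?B) J (Pi\<^sub>E J A) = {w. \<forall>i<n. w i \<in> F i}"
    using n by (auto simp: prod_emb_def F_def PiE_iff restrict_def extensional_def subset_iff)
  have sets: "prod_emb UNIV (\<lambda>_. ?B) J (Pi\<^sub>E J A) \<in> sets ?P"
    using J by (intro sets_PiM_I) auto
  have UN: "{x \<in> {0..<1}. \<forall>i<n. binary_digits x i \<in> F i} = (\<Union>w\<in>?W. ?C w)"
  proof (intro subset_antisym subsetI)
    fix x assume "x \<in> {x \<in> {0..<1}. \<forall>i<n. binary_digits x i \<in> F i}"
    then show "x \<in> (\<Union>w\<in>?W. ?C w)"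
      by (intro UN_I[of "restrict (binary_digits x) {..<n}"]) (auto simp: agree_def)
  qed (auto simp: agree_def PiE_iff)
  have disj: "disjoint_family_on ?C ?W"
    unfolding disjoint_family_on_def
  proof (intro ballI impI)
    fix v w assume vw: "v \<in> ?W" "w \<in> ?W" "v \<noteq> w"
    then have "\<not> agree n v w"
      using PiE_ext[OF vw(1,2)] by (auto simp: agree_def)
    then show "?C v \<inter> ?C w = {}" using agree_sym agree_trans by blast
  qed
  \<comment> \<open>Measurability follows from the positive value, because \<open>emeasure\<close>
    is 0 on nonmeasurable sets.\<close>
  have "?C w \<in> sets unit_lebesgue" for w
    by (rule emeasure_neq_0_sets, subst emeasure_cylinder) simp
  then have meas: "?C ` ?W \<subseteq> sets unit_lebesgue"
    by blast
  have "emeasure (distr unit_lebesgue ?P binary_digits) (prod_emb UNIV (\<lambda>_. ?B) J (Pi\<^sub>E J A))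
      = emeasure unit_lebesgue {x \<in> {0..<1}. \<forall>i<n. binary_digits x i \<in> F i}"
    using measurable_binary_digits sets
    by (subst emeasure_distr) (auto simp: bernoulli_boundary_def emb intro!: arg_cong[where f = "emeasure _"])
  also have "\<dots> = (\<Sum>w\<in>?W. ennreal (1 / 2 ^ n))"
    unfolding UN sum_emeasure[OF meas disj fin, symmetric] by (simp only: emeasure_cylinder)
  also have "\<dots> = ennreal (real (\<Prod>i<n. card (F i)) / 2 ^ n)"
    by (simp add: card_PiE ennreal_of_nat_eq_real_of_nat ennreal_mult[symmetric] prod_nonneg)
  also have "\<dots> = ennreal (\<Prod>i<n. real (card (F i)) / 2)"
    by (simp add: prod_dividef)
  also have "\<dots> = (\<Prod>i<n. emeasure ?B (F i))"
    by (simp add: emeasure_bernoulli_half prod_ennreal)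
  also have "\<dots> = (\<Prod>i\<in>J. emeasure ?B (A i))"
  proof (rule prod.mono_neutral_cong_right)
    show "\<forall>i\<in>{..<n} - J. emeasure ?B (F i) = 1"
      using measure_pmf.emeasure_space_1[of "bernoulli_pmf (1 / 2)"] by (simp add: F_def)
  qed (use n in \<open>auto simp: F_def\<close>)
  also have "\<dots> = emeasure ?P (prod_emb UNIV (\<lambda>_. ?B) J (Pi\<^sub>E J A))"
    using J by (subst emeasure_PiM_emb) auto
  finally show "emeasure (distr unit_lebesgue ?P binary_digits) (prod_emb UNIV (\<lambda>_. ?B) J (Pi\<^sub>E J A))
      = emeasure ?P (prod_emb UNIV (\<lambda>_. ?B) J (Pi\<^sub>E J A))" .
next
  have "emeasure unit_lebesgue (space unit_lebesgue) = 1"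
    by (simp add: emeasure_restrict_space)
  then interpret prob_space unit_lebesgue by (rule prob_spaceI)
  show "finite_measure (distr unit_lebesgue (\<Pi>\<^sub>M i\<in>(UNIV::nat set). measure_pmf (bernoulli_pmf (1 / 2))) binary_digits)"
    using measurable_binary_digits unfolding bernoulli_boundary_def by (rule finite_measure_distr)
qed simp_all

section \<open>Conjugacy with a rotated odometer and the resulting orbit structure\<close>

theorem theorem1p8:
  fixes g :: "bool list \<Rightarrow> bool list" and m :: nat
  assumes g_aut: "tree_aut g"
    and m_pos: "m \<ge> 1"
    and g_fin: "\<forall>i\<ge>m. \<forall>w. tree_act g w i = w i"
  shows "((\<exists>\<pi>. \<pi> permutes {..<2 ^ m} \<and>
              (\<exists>\<phi>. inj_on \<phi> {0..<1} \<and>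
                   measure_preserving_map unit_lebesgue bernoulli_boundary \<phi> \<and>
                   (\<forall>x\<in>{0..<1}. \<phi> (rotated_odometer (2 ^ m) \<pi> x)
                        = (adding_machine \<circ> tree_act g) (\<phi> x)))))
       \<and> (\<forall>n>0. (adding_machine \<circ> tree_act g) ^^ n \<noteq> id)
       \<and> (\<exists>U. openin boundary_top U \<and> closedin boundary_top U \<and> U \<noteq> {} \<and>
              (adding_machine \<circ> tree_act g) ` U = U \<and>
              (\<forall>x\<in>U. U \<subseteq> boundary_top closure_of cyc_orbit (adding_machine \<circ> tree_act g) x) \<and>
              (\<exists>n0::nat. \<forall>x. x \<notin> U \<longrightarrow>
                 (\<exists>k\<le>n0. ((adding_machine \<circ> tree_act g) ^^ (2 ^ k)) x = x \<and>
                    (\<forall>j. 0 < j \<and> j < 2 ^ k \<longrightarrow> ((adding_machine \<circ> tree_act g) ^^ j) x \<noteq> x))))"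
proof -
  interpret finitary_odometer "tree_act g" m
    by unfold_locales (use g_aut g_fin level_isometry_tree_act surj_tree_act in auto)
  have h: "adding_machine \<circ> tree_act g = h"
    by (simp add: h_def)
  have digits: "binary_digits (rotated_odometer (2 ^ m) (prefix_perm (tree_act g) m) x) = h (binary_digits x)"
    if "x \<in> {0..<1}" for x
    using rot_perm_binary_digits[OF G_isometry G_tail that] binary_digits_vnk
    by (simp add: rotated_odometer_def h_def)
  have closure: "U \<subseteq> boundary_top closure_of cyc_orbit h x" if "x \<in> U" for x
  proof
    fix y assume "y \<in> U"
    show "y \<in> boundary_top closure_of cyc_orbit h x"
    proof (rule in_closure_of_boundary_topI)
      fix n
      obtain t where "agree n ((h ^^ t) x) y"
        using U_minimal[OF \<open>x \<in> U\<close> \<open>y \<in> U\<close>] by blast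
      moreover have "(h ^^ t) x \<in> cyc_orbit h x"
        unfolding cyc_orbit_def by blast
      ultimately show "\<exists>z\<in>cyc_orbit h x. agree n z y" by blast
    qed
  qed
  show ?thesis
    unfolding h
  proof (intro conjI)
    show "\<exists>\<pi>. \<pi> permutes {..<2 ^ m} \<and>
      (\<exists>\<phi>. inj_on \<phi> {0..<1} \<and> measure_preserving_map unit_lebesgue bernoulli_boundary \<phi> \<and>
        (\<forall>x\<in>{0..<1}. \<phi> (rotated_odometer (2 ^ m) \<pi> x) = h (\<phi> x)))"
      using prefix_perm_permutes[OF G_isometry] inj_on_binary_digits digits
      by (intro exI[of _ "prefix_perm (tree_act g) m"] exI[of _ binary_digits] conjI ballI)
        (simp_all add: measure_preserving_map_def measurable_binary_digits distr_binary_digits)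
    show "\<forall>n>0. h ^^ n \<noteq> id"
      using infinite_order by blast
    show "\<exists>U. openin boundary_top U \<and> closedin boundary_top U \<and> U \<noteq> {} \<and> h ` U = U \<and>
      (\<forall>x\<in>U. U \<subseteq> boundary_top closure_of cyc_orbit h x) \<and>
      (\<exists>n0::nat. \<forall>x. x \<notin> U \<longrightarrow> (\<exists>k\<le>n0. (h ^^ (2 ^ k)) x = x \<and>
        (\<forall>j. 0 < j \<and> j < 2 ^ k \<longrightarrow> (h ^^ j) x \<noteq> x)))"
      by (rule exI[of _ U])
        (intro conjI ballI exI[of _ m] allI impI U_clopen U_nonempty h_image_U closure periodic_outside_U; assumption)
  qed
qed

end
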